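(* Let $A$ be a Noetherian ring and let $R$ be a domain that is an $A$-algebra essentially of finite type. Suppose that $0\ne I\subseteq R$ is a $D_A(R)$-submodule of $R$. Then $\overline{I}^{\mathrm{diff}_A}=R$. In particular, $\sqrt{J}=\overline{J}^{\mathrm{diff}_A}$ for all ideals $J\subseteq R$ if and only if $R$ is a simple $D_A(R)$-module.
   Context: Rings $A$ and $R$ are commutative. For $P,Q\in\operatorname{End}_A(R)$, put $[P,Q]=P\cdot Q-Q\cdot P$, and identify $a\in R$ with the endomorphism "multiplication by $a$". Let $D^0_A(R)\subseteq\operatorname{End}_A(R)$ be the set of multiplications by elements of $R$; for $i>0$ let $D^i_A(R)=\{\partial\in\operatorname{End}_A(R)\mid[\partial,a]\in D^{i-1}_A(R)\text{ for all }a\in R\}$; and $D_A(R)=\bigcup_{i\ge0}D^i_A(R)$, the ring of $A$-linear differential operators, over which $R$ is naturally a left module. $R$ is a simple $D_A(R)$-module if its only $D_A(R)$-submodules are $0$ and $R$. For an ideal $I\subseteq R$ and a positive integer $n$, the $n$-th differential power is the ideal $I^{\langle n\rangle_A}=\{r\in R\mid\partial(r)\in I\text{ for all }\partial\in D^{n-1}_A(R)\}$. For $R$ a domain, the differential closure of $I$ with respect to $A$ is the set $\overline{I}^{\mathrm{diff}_A}=\{r\in R\mid\text{there exists }0\ne c\in R\text{ such that }cr^n\in I^{\langle n\rangle_A}\text{ for all }n\gg0\}$. *)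

theory Defs
  imports "HOL-Algebra.Algebra"
begin

text \<open>Throughout, an algebra \<open>R\<close> over \<open>A\<close> is given by its unital structure map
  \<open>\<phi> \<in> ring_hom A R\<close>.\<close>

definition finite_type_algebra ::
    "('a, 'm) ring_scheme \<Rightarrow> ('a \<Rightarrow> 'b) \<Rightarrow> ('b, 'n) ring_scheme \<Rightarrow> bool"
  where "finite_type_algebra A \<phi> B \<longleftrightarrow>
    \<phi> \<in> ring_hom A B \<and>
    (\<exists>S. finite S \<and> S \<subseteq> carrier B \<and> generate_ring B (\<phi> ` carrier A \<union> S) = carrier B)"

text \<open>\<open>is_localization B W \<psi> R\<close>: the homomorphism \<open>\<psi>\<close> exhibits \<open>R\<close> as the ring of fractions
  of \<open>B\<close> with denominators in \<open>W\<close> (\<open>W\<close> may contain zero divisors).\<close>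

definition is_localization ::
    "('b, 'm) ring_scheme \<Rightarrow> 'b set \<Rightarrow> ('b \<Rightarrow> 'r) \<Rightarrow> ('r, 'n) ring_scheme \<Rightarrow> bool"
  where "is_localization B W \<psi> R \<longleftrightarrow>
    \<psi> \<in> ring_hom B R \<and> submonoid W B \<and> \<psi> ` W \<subseteq> Units R \<and>
    (\<forall>r \<in> carrier R. \<exists>b \<in> carrier B. \<exists>w \<in> W. r = \<psi> b \<otimes>\<^bsub>R\<^esub> inv\<^bsub>R\<^esub> (\<psi> w)) \<and>
    (\<forall>b \<in> carrier B. \<psi> b = \<zero>\<^bsub>R\<^esub> \<longleftrightarrow> (\<exists>w \<in> W. w \<otimes>\<^bsub>B\<^esub> b = \<zero>\<^bsub>B\<^esub>))"

text \<open>The ring \<open>End\<^sub>A(R)\<close>. Its elements are extensional functions (undefined off the carrier), so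
  that equality in this ring is equality of maps on \<open>carrier R\<close>.\<close>

definition End_ring ::
    "('a, 'm) ring_scheme \<Rightarrow> ('a \<Rightarrow> 'r) \<Rightarrow> ('r, 'n) ring_scheme \<Rightarrow> ('r \<Rightarrow> 'r) ring"
  where "End_ring A \<phi> R =
    \<lparr> carrier = {f \<in> carrier R \<rightarrow>\<^sub>E carrier R.
        (\<forall>x \<in> carrier R. \<forall>y \<in> carrier R. f (x \<oplus>\<^bsub>R\<^esub> y) = f x \<oplus>\<^bsub>R\<^esub> f y) \<and>
        (\<forall>a \<in> carrier A. \<forall>x \<in> carrier R. f (\<phi> a \<otimes>\<^bsub>R\<^esub> x) = \<phi> a \<otimes>\<^bsub>R\<^esub> f x)},
      monoid.mult = compose (carrier R),
      monoid.one = (\<lambda>x \<in> carrier R. x),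
      ring.zero = (\<lambda>x \<in> carrier R. \<zero>\<^bsub>R\<^esub>),
      ring.add = (\<lambda>f g. \<lambda>x \<in> carrier R. f x \<oplus>\<^bsub>R\<^esub> g x) \<rparr>"

definition mult_op :: "('r, 'n) ring_scheme \<Rightarrow> 'r \<Rightarrow> ('r \<Rightarrow> 'r)"
  where "mult_op R a = (\<lambda>x \<in> carrier R. a \<otimes>\<^bsub>R\<^esub> x)"

definition commutator :: "('e, 'm) ring_scheme \<Rightarrow> 'e \<Rightarrow> 'e \<Rightarrow> 'e"
  where "commutator E P Q = (P \<otimes>\<^bsub>E\<^esub> Q) \<ominus>\<^bsub>E\<^esub> (Q \<otimes>\<^bsub>E\<^esub> P)"

primrec diff_ops_le ::
    "('a, 'm) ring_scheme \<Rightarrow> ('a \<Rightarrow> 'r) \<Rightarrow> ('r, 'n) ring_scheme \<Rightarrow> nat \<Rightarrow> ('r \<Rightarrow> 'r) set"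
  where
    "diff_ops_le A \<phi> R 0 = mult_op R ` carrier R"
  | "diff_ops_le A \<phi> R (Suc i) =
      {P \<in> carrier (End_ring A \<phi> R). \<forall>a \<in> carrier R.
         commutator (End_ring A \<phi> R) P (mult_op R a) \<in> diff_ops_le A \<phi> R i}"

definition diff_ops ::
    "('a, 'm) ring_scheme \<Rightarrow> ('a \<Rightarrow> 'r) \<Rightarrow> ('r, 'n) ring_scheme \<Rightarrow> ('r \<Rightarrow> 'r) set"
  where "diff_ops A \<phi> R = (\<Union>i. diff_ops_le A \<phi> R i)"

definition D_submodule ::
    "('a, 'm) ring_scheme \<Rightarrow> ('a \<Rightarrow> 'r) \<Rightarrow> ('r, 'n) ring_scheme \<Rightarrow> 'r set \<Rightarrow> bool"
  where "D_submodule A \<phi> R N \<longleftrightarrow>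
    additive_subgroup N R \<and> (\<forall>P \<in> diff_ops A \<phi> R. \<forall>x \<in> N. P x \<in> N)"

definition D_simple ::
    "('a, 'm) ring_scheme \<Rightarrow> ('a \<Rightarrow> 'r) \<Rightarrow> ('r, 'n) ring_scheme \<Rightarrow> bool"
  where "D_simple A \<phi> R \<longleftrightarrow>
    (\<forall>N. D_submodule A \<phi> R N \<longrightarrow> N = {\<zero>\<^bsub>R\<^esub>} \<or> N = carrier R)"

text \<open>Differential powers are meaningful only for \<open>n \<ge> 1\<close>; at \<open>n = 0\<close> truncated subtraction gives
  a junk value, which the differential closure does not see.\<close>

definition diff_power ::
    "('a, 'm) ring_scheme \<Rightarrow> ('a \<Rightarrow> 'r) \<Rightarrow> ('r, 'n) ring_scheme \<Rightarrow> 'r set \<Rightarrow> nat \<Rightarrow> 'r set"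
  where "diff_power A \<phi> R I n =
    {r \<in> carrier R. \<forall>P \<in> diff_ops_le A \<phi> R (n - 1). P r \<in> I}"

definition diff_closure ::
    "('a, 'm) ring_scheme \<Rightarrow> ('a \<Rightarrow> 'r) \<Rightarrow> ('r, 'n) ring_scheme \<Rightarrow> 'r set \<Rightarrow> 'r set"
  where "diff_closure A \<phi> R I =
    {r \<in> carrier R. \<exists>c \<in> carrier R - {\<zero>\<^bsub>R\<^esub>}.
       \<forall>\<^sub>F n in sequentially. c \<otimes>\<^bsub>R\<^esub> r [^]\<^bsub>R\<^esub> n \<in> diff_power A \<phi> R I n}"

definition radical :: "('r, 'n) ring_scheme \<Rightarrow> 'r set \<Rightarrow> 'r set"
  where "radical R J = {r \<in> carrier R. \<exists>n::nat. n \<ge> 1 \<and> r [^]\<^bsub>R\<^esub> n \<in> J}"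

end

theory Submission
  imports Defs
begin

text \<open>The theorem comes down to how the order of a differential operator changes when a
  factor from \<open>R\<close> is moved across it: the error is a commutator, which has smaller order.

  A nonzero \<open>D\<close>-submodule \<open>I\<close> has differential closure \<open>R\<close> because \<open>I\<close> absorbs both the
  multiplications and all other operators: any nonzero \<open>c \<in> I\<close> serves as the multiplier \<open>c\<close>
  in the definition of the closure, for every \<open>r\<close> at once. If differential closures are radicals, then \<open>\<surd>I = R\<close> for such an \<open>I\<close>, so \<open>I = R\<close>.

  The radical \<open>\<surd>J\<close> always lies in the differential closure: an operator of order at most
  \<open>n - 1\<close> lowers the exponent of a power of \<open>r\<close> by at most \<open>n - 1\<close>
  (\<open>power_order_drop\<close>), so for \<open>r \<noteq> 0\<close> with
  \<open>r\<^sup>m \<in> J\<close> the element \<open>c = r\<^sup>m\<close> is a multiplier for \<open>r\<close>.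

  For the reverse inclusion suppose that \<open>r \<notin> \<surd>J\<close>, \<open>c \<noteq> 0\<close> and \<open>c r\<^sup>n \<in> J\<^bsup>\<langle>n\<rangle>\<^esup>\<close> for large \<open>n\<close>. Replace \<open>J\<close>
  by its saturation \<open>K = (J : r\<^sup>\<infinity>)\<close>. It is proper, and \<open>r\<close> is regular modulo \<open>K\<close>, whence
  \<open>r\<close> is also regular modulo every differential power of \<open>K\<close> (\<open>cancel_power\<close>); so \<open>P c \<in> K\<close>
  for every operator \<open>P\<close>. The elements \<open>x\<close> with \<open>P x \<in> K\<close> for all \<open>P\<close> form a \<open>D\<close>-submodule
  (\<open>D_core_submodule\<close>), since operators are closed under composition. It contains \<open>c \<noteq> 0\<close> but
  not \<open>1\<close>, so \<open>R\<close> is not \<open>D\<close>-simple. The saturation plays the part that a prime ideal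
  containing \<open>J\<close> but not \<open>r\<close> would play.\<close>

section \<open>The endomorphism ring and commutators\<close>

locale comm_algebra = cring R for R :: "('r, 'm) ring_scheme" (structure) +
  fixes A :: "('a, 'k) ring_scheme" and \<phi> :: "'a \<Rightarrow> 'r"
  assumes structure_map: "\<phi> \<in> ring_hom A R"
begin

abbreviation E where "E \<equiv> End_ring A \<phi> R"
abbreviation D where "D \<equiv> diff_ops_le A \<phi> R"

lemma structure_map_closed [simp]: "a \<in> carrier A \<Longrightarrow> \<phi> a \<in> carrier R"
  using structure_map by (rule ring_hom_closed)

lemma End_iff: "f \<in> carrier E \<longleftrightarrow> f \<in> carrier R \<rightarrow>\<^sub>E carrier R \<and>
    (\<forall>x \<in> carrier R. \<forall>y \<in> carrier R. f (x \<oplus> y) = f x \<oplus> f y) \<and>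
    (\<forall>a \<in> carrier A. \<forall>x \<in> carrier R. f (\<phi> a \<otimes> x) = \<phi> a \<otimes> f x)"
  by (simp add: End_ring_def)

lemma End_closed [simp]: "f \<in> carrier E \<Longrightarrow> x \<in> carrier R \<Longrightarrow> f x \<in> carrier R"
  by (auto simp: End_iff)

lemma End_add: "f \<in> carrier E \<Longrightarrow> x \<in> carrier R \<Longrightarrow> y \<in> carrier R \<Longrightarrow> f (x \<oplus> y) = f x \<oplus> f y"
  by (auto simp: End_iff)

lemma End_scalar:
  "f \<in> carrier E \<Longrightarrow> a \<in> carrier A \<Longrightarrow> x \<in> carrier R \<Longrightarrow> f (\<phi> a \<otimes> x) = \<phi> a \<otimes> f x"
  by (auto simp: End_iff)

lemma End_zero: assumes "f \<in> carrier E" shows "f \<zero> = \<zero>"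
  using End_add[OF assms, of \<zero> \<zero>] End_closed[OF assms, of \<zero>]
  by (metis add.l_cancel_one' l_zero zero_closed)

lemma End_minus:
  assumes "f \<in> carrier E" "x \<in> carrier R" "y \<in> carrier R"
  shows "f (x \<ominus> y) = f x \<ominus> f y"
proof -
  have "f (x \<ominus> y) \<oplus> f y = f x"
    using assms by (simp add: End_add[symmetric] minus_eq a_assoc l_neg)
  then show ?thesis
    using assms by (simp add: minus_eq add.inv_solve_right)
qed

lemma End_ext:
  assumes "f \<in> carrier E" "g \<in> carrier E" "\<And>x. x \<in> carrier R \<Longrightarrow> f x = g x"
  shows "f = g"
  using assms by (auto simp: End_iff intro: PiE_ext)

lemma E_add_apply [simp]: "x \<in> carrier R \<Longrightarrow> (f \<oplus>\<^bsub>E\<^esub> g) x = f x \<oplus> g x"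
  by (simp add: End_ring_def)

lemma E_mult_apply [simp]: "x \<in> carrier R \<Longrightarrow> (f \<otimes>\<^bsub>E\<^esub> g) x = f (g x)"
  by (simp add: End_ring_def compose_def)

lemma E_zero_apply [simp]: "x \<in> carrier R \<Longrightarrow> \<zero>\<^bsub>E\<^esub> x = \<zero>"
  by (simp add: End_ring_def)

lemma E_zero_closed: "\<zero>\<^bsub>E\<^esub> \<in> carrier E"
  by (simp add: End_iff) (simp add: End_ring_def)

lemma E_add_closed:
  assumes "f \<in> carrier E" "g \<in> carrier E" shows "f \<oplus>\<^bsub>E\<^esub> g \<in> carrier E"
proof -
  have "f \<oplus>\<^bsub>E\<^esub> g \<in> carrier R \<rightarrow>\<^sub>E carrier R"
    using End_closed[OF assms(1)] End_closed[OF assms(2)]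
    by (simp add: End_ring_def restrict_PiE_iff)
  then show ?thesis
    using assms by (subst End_iff) (simp add: End_add End_scalar a_ac r_distr)
qed

lemma E_mult_closed:
  assumes "f \<in> carrier E" "g \<in> carrier E" shows "f \<otimes>\<^bsub>E\<^esub> g \<in> carrier E"
proof -
  have "f \<otimes>\<^bsub>E\<^esub> g \<in> carrier R \<rightarrow>\<^sub>E carrier R"
    using End_closed[OF assms(1)] End_closed[OF assms(2)]
    by (simp add: End_ring_def compose_def restrict_PiE_iff)
  then show ?thesis
    using assms by (subst End_iff) (simp add: End_add End_scalar)
qed

lemma E_neg:
  assumes "f \<in> carrier E"
  shows "\<exists>g \<in> carrier E. g \<oplus>\<^bsub>E\<^esub> f = \<zero>\<^bsub>E\<^esub>"
proof -
  let ?g = "\<lambda>x \<in> carrier R. \<ominus> f x"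
  have "?g \<in> carrier E"
    using assms by (auto simp: End_iff PiE_iff minus_add r_minus)
  moreover have "?g \<oplus>\<^bsub>E\<^esub> f = \<zero>\<^bsub>E\<^esub>"
    by (rule End_ext[OF E_add_closed[OF calculation assms] E_zero_closed])
       (use assms in \<open>simp add: l_neg\<close>)
  ultimately show ?thesis by blast
qed

lemma E_abelian_group: "abelian_group E"
proof (rule abelian_groupI)
  fix x y z assume xyz: "x \<in> carrier E" "y \<in> carrier E" "z \<in> carrier E"
  show "x \<oplus>\<^bsub>E\<^esub> y \<oplus>\<^bsub>E\<^esub> z = x \<oplus>\<^bsub>E\<^esub> (y \<oplus>\<^bsub>E\<^esub> z)"
    by (rule End_ext) (use xyz in \<open>simp_all add: E_add_closed a_assoc\<close>)
next
  fix x y assume xy: "x \<in> carrier E" "y \<in> carrier E"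
  show "x \<oplus>\<^bsub>E\<^esub> y = y \<oplus>\<^bsub>E\<^esub> x"
    by (rule End_ext) (use xy in \<open>simp_all add: E_add_closed a_comm\<close>)
next
  fix x assume x: "x \<in> carrier E"
  show "\<zero>\<^bsub>E\<^esub> \<oplus>\<^bsub>E\<^esub> x = x"
    by (rule End_ext) (use x in \<open>simp_all add: E_add_closed E_zero_closed\<close>)
qed (simp_all add: E_add_closed E_zero_closed E_neg)

lemma E_minus_closed: "f \<in> carrier E \<Longrightarrow> g \<in> carrier E \<Longrightarrow> f \<ominus>\<^bsub>E\<^esub> g \<in> carrier E"
  by (rule abelian_group.minus_closed[OF E_abelian_group])

lemma E_minus_apply:
  assumes "f \<in> carrier E" "g \<in> carrier E" "x \<in> carrier R"
  shows "(f \<ominus>\<^bsub>E\<^esub> g) x = f x \<ominus> g x"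
proof -
  interpret E: abelian_group E by (rule E_abelian_group)
  have "(f \<ominus>\<^bsub>E\<^esub> g) \<oplus>\<^bsub>E\<^esub> g = f"
    using assms by (simp add: E.minus_eq E.a_assoc E.l_neg)
  then have "(f \<ominus>\<^bsub>E\<^esub> g) x \<oplus> g x = f x"
    using assms(3) by (metis E_add_apply)
  moreover have "(f \<ominus>\<^bsub>E\<^esub> g) x \<in> carrier R"
    using assms by (simp add: E_minus_closed)
  ultimately show ?thesis
    using assms by (simp add: minus_eq add.inv_solve_right)
qed

lemma mult_op_apply [simp]: "x \<in> carrier R \<Longrightarrow> mult_op R a x = a \<otimes> x"
  by (simp add: mult_op_def)

lemma mult_op_closed: "a \<in> carrier R \<Longrightarrow> mult_op R a \<in> carrier E"
  by (auto simp: End_iff mult_op_def PiE_iff r_distr m_ac)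

abbreviation bracket where "bracket P a \<equiv> commutator E P (mult_op R a)"

lemma bracket_closed: "P \<in> carrier E \<Longrightarrow> a \<in> carrier R \<Longrightarrow> bracket P a \<in> carrier E"
  unfolding commutator_def by (intro E_minus_closed E_mult_closed mult_op_closed)

lemma bracket_apply:
  "P \<in> carrier E \<Longrightarrow> a \<in> carrier R \<Longrightarrow> x \<in> carrier R \<Longrightarrow> bracket P a x = P (a \<otimes> x) \<ominus> a \<otimes> P x"
  unfolding commutator_def by (simp add: E_minus_apply E_mult_closed mult_op_closed)

text \<open>This form of the commutator drives every induction on the order: moving a factor out of
  \<open>P\<close> costs an operator of smaller order.\<close>

lemma bracket_expand:
  assumes "P \<in> carrier E" "a \<in> carrier R" "x \<in> carrier R"
  shows "P (a \<otimes> x) = bracket P a x \<oplus> a \<otimes> P x"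
  using assms by (simp add: bracket_apply minus_eq a_assoc l_neg)

section \<open>The order filtration\<close>

lemma D_carrier: "P \<in> D i \<Longrightarrow> P \<in> carrier E"
  by (cases i) (auto simp: mult_op_closed)

lemma D_bracket: "P \<in> D (Suc i) \<Longrightarrow> a \<in> carrier R \<Longrightarrow> bracket P a \<in> D i"
  by simp

lemma zero_in_D0: "\<zero>\<^bsub>E\<^esub> \<in> D 0"
proof -
  have "\<zero>\<^bsub>E\<^esub> = mult_op R \<zero>"
    by (rule End_ext) (simp_all add: E_zero_closed mult_op_closed)
  then show ?thesis by simp
qed

lemma bracket_mult_op:
  assumes "a \<in> carrier R" "b \<in> carrier R" shows "bracket (mult_op R a) b = \<zero>\<^bsub>E\<^esub>"
  by (rule End_ext)
     (use assms in \<open>simp_all add: bracket_closed mult_op_closed E_zero_closed bracket_apply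
        m_lcomm minus_eq r_neg\<close>)

lemma D_Suc: "P \<in> D i \<Longrightarrow> P \<in> D (Suc i)"
proof (induction i arbitrary: P)
  case 0
  then obtain a where "a \<in> carrier R" "P = mult_op R a" by auto
  then show ?case using zero_in_D0 by (simp add: mult_op_closed bracket_mult_op)
next
  case (Suc i)
  have "bracket P a \<in> D (Suc i)" if "a \<in> carrier R" for a
    by (rule Suc.IH[OF D_bracket[OF Suc.prems that]])
  with D_carrier[OF Suc.prems] show ?case
    by (subst diff_ops_le.simps(2)) blast
qed

lemma D_mono: "i \<le> j \<Longrightarrow> D i \<subseteq> D j"
  by (rule lift_Suc_mono_le[of D]) (blast intro: D_Suc)+

lemma D_add: "P \<in> D i \<Longrightarrow> Q \<in> D i \<Longrightarrow> P \<oplus>\<^bsub>E\<^esub> Q \<in> D i"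
proof (induction i arbitrary: P Q)
  case 0
  then obtain a b where ab: "a \<in> carrier R" "P = mult_op R a" "b \<in> carrier R" "Q = mult_op R b"
    by auto
  have "P \<oplus>\<^bsub>E\<^esub> Q = mult_op R (a \<oplus> b)"
    by (rule End_ext) (use ab in \<open>simp_all add: E_add_closed mult_op_closed l_distr\<close>)
  then show ?case using ab by simp
next
  case (Suc i)
  note PQ = D_carrier[OF Suc.prems(1)] D_carrier[OF Suc.prems(2)]
  have "bracket (P \<oplus>\<^bsub>E\<^esub> Q) a \<in> D i" if a: "a \<in> carrier R" for a
  proof -
    have "bracket (P \<oplus>\<^bsub>E\<^esub> Q) a = bracket P a \<oplus>\<^bsub>E\<^esub> bracket Q a"
      by (rule End_ext)
         (use PQ a in \<open>simp_all add: E_add_closed bracket_closed bracket_apply minus_eq r_distr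
            minus_add a_ac\<close>)
    with Suc.IH[OF D_bracket[OF Suc.prems(1) a] D_bracket[OF Suc.prems(2) a]] show ?thesis
      by simp
  qed
  with E_add_closed[OF PQ] show ?case by simp
qed

lemma mult_op_comp_D:
  assumes a: "a \<in> carrier R" shows "Q \<in> D j \<Longrightarrow> mult_op R a \<otimes>\<^bsub>E\<^esub> Q \<in> D j"
proof (induction j arbitrary: Q)
  case 0
  then obtain b where b: "b \<in> carrier R" "Q = mult_op R b" by auto
  have "mult_op R a \<otimes>\<^bsub>E\<^esub> Q = mult_op R (a \<otimes> b)"
    by (rule End_ext) (use a b in \<open>simp_all add: E_mult_closed mult_op_closed m_assoc\<close>)
  then show ?case using a b by simp
next
  case (Suc j)
  note Q = D_carrier[OF Suc.prems]
  have "bracket (mult_op R a \<otimes>\<^bsub>E\<^esub> Q) b \<in> D j" if b: "b \<in> carrier R" for b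
  proof -
    have "bracket (mult_op R a \<otimes>\<^bsub>E\<^esub> Q) b = mult_op R a \<otimes>\<^bsub>E\<^esub> bracket Q b"
      by (rule End_ext)
         (use a b Q in \<open>simp_all add: E_mult_closed mult_op_closed bracket_closed bracket_apply
            minus_eq r_distr r_minus m_lcomm\<close>)
    with Suc.IH[OF D_bracket[OF Suc.prems b]] show ?thesis by simp
  qed
  with E_mult_closed[OF mult_op_closed[OF a] Q] show ?case by simp
qed

lemma D_comp_mult_op:
  assumes a: "a \<in> carrier R" shows "P \<in> D i \<Longrightarrow> P \<otimes>\<^bsub>E\<^esub> mult_op R a \<in> D i"
proof (induction i arbitrary: P)
  case 0
  then show ?case using mult_op_comp_D[of _ "mult_op R a" 0] a by auto
next
  case (Suc i)
  note P = D_carrier[OF Suc.prems]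
  have "bracket (P \<otimes>\<^bsub>E\<^esub> mult_op R a) b \<in> D i" if b: "b \<in> carrier R" for b
  proof -
    have "bracket (P \<otimes>\<^bsub>E\<^esub> mult_op R a) b = bracket P b \<otimes>\<^bsub>E\<^esub> mult_op R a"
      by (rule End_ext)
         (use a b P in \<open>simp_all add: E_mult_closed mult_op_closed bracket_closed bracket_apply
            m_lcomm\<close>)
    with Suc.IH[OF D_bracket[OF Suc.prems b]] show ?thesis by simp
  qed
  with E_mult_closed[OF P mult_op_closed[OF a]] show ?case by simp
qed

lemma bracket_comp:
  assumes P: "P \<in> carrier E" and Q: "Q \<in> carrier E" and a: "a \<in> carrier R"
  shows "bracket (P \<otimes>\<^bsub>E\<^esub> Q) a = P \<otimes>\<^bsub>E\<^esub> bracket Q a \<oplus>\<^bsub>E\<^esub> bracket P a \<otimes>\<^bsub>E\<^esub> Q"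
proof (rule End_ext)
  fix x assume x: "x \<in> carrier R"
  let ?u = "P (Q (a \<otimes> x))" and ?v = "P (a \<otimes> Q x)" and ?w = "a \<otimes> P (Q x)"
  have c: "?u \<in> carrier R" "?v \<in> carrier R" "?w \<in> carrier R"
    using P Q a x by simp_all
  then have "?u \<ominus> ?w = (?u \<ominus> ?v) \<oplus> (?v \<ominus> ?w)"
    by (simp add: minus_eq a_assoc r_neg1)
  then show "bracket (P \<otimes>\<^bsub>E\<^esub> Q) a x = (P \<otimes>\<^bsub>E\<^esub> bracket Q a \<oplus>\<^bsub>E\<^esub> bracket P a \<otimes>\<^bsub>E\<^esub> Q) x"
    using P Q a x by (simp add: bracket_apply E_mult_closed End_minus)
qed (use assms in \<open>simp_all add: E_mult_closed E_add_closed bracket_closed\<close>)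

text \<open>By the Leibniz rule \<open>[PQ, a] = P[Q, a] + [P, a]Q\<close>, both summands of the commutator have
  smaller total order, so induction on the two orders applies.\<close>

lemma D_comp: "P \<in> D i \<Longrightarrow> Q \<in> D j \<Longrightarrow> P \<otimes>\<^bsub>E\<^esub> Q \<in> D (i + j)"
proof (induction i arbitrary: P j Q)
  case 0
  then show ?case using mult_op_comp_D by auto
next
  case (Suc i)
  note outer = Suc.IH and P = \<open>P \<in> D (Suc i)\<close>
  from \<open>Q \<in> D j\<close> show ?case
  proof (induction j arbitrary: Q)
    case 0
    then show ?case using D_comp_mult_op[OF _ P] by auto
  next
    case (Suc j)
    note Q = Suc.prems
    have "bracket (P \<otimes>\<^bsub>E\<^esub> Q) a \<in> D (i + Suc j)" if a: "a \<in> carrier R" for a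
    proof -
      have "P \<otimes>\<^bsub>E\<^esub> bracket Q a \<in> D (i + Suc j)"
        using Suc.IH[OF D_bracket[OF Q a]] by simp
      then show ?thesis
        using D_add[OF _ outer[OF D_bracket[OF P a] Q]] bracket_comp[OF D_carrier[OF P] D_carrier[OF Q] a]
        by simp
    qed
    with E_mult_closed[OF D_carrier[OF P] D_carrier[OF Q]] show ?case by simp
  qed
qed

lemma mult_op_diff_op: "a \<in> carrier R \<Longrightarrow> mult_op R a \<in> diff_ops A \<phi> R"
  unfolding diff_ops_def by (rule UN_I[of 0]) auto

lemma D_submodule_absorbs:
  assumes "D_submodule A \<phi> R N" "a \<in> carrier R" "x \<in> N"
  shows "a \<otimes> x \<in> N"
proof -
  have "x \<in> carrier R"
    using assms unfolding D_submodule_def by (blast dest: additive_subgroup.a_subset)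
  then show ?thesis
    using assms mult_op_diff_op unfolding D_submodule_def by (metis mult_op_apply)
qed

lemma D_submodule_ideal: assumes "D_submodule A \<phi> R N" shows "ideal N R"
proof -
  interpret additive_subgroup N R using assms by (simp add: D_submodule_def)
  show ?thesis
  proof (intro ideal.intro ideal_axioms.intro)
    fix a x assume "a \<in> N" "x \<in> carrier R"
    then show "x \<otimes> a \<in> N" "a \<otimes> x \<in> N"
      using D_submodule_absorbs[OF assms, of x a] a_Hcarr by (simp_all add: m_comm[of a x])
  qed (unfold_locales)
qed

section \<open>Radicals and differential powers\<close>

text \<open>An operator of order \<open>i\<close> lowers the exponent of a power of \<open>r\<close> by at most \<open>i\<close>. In
  \<open>P(r r\<^bsup>i+m\<^esup>x)\<close> one either extracts the factor \<open>r\<close>, lowering the exponent but keeping the order,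
  or spends it on the commutator \<open>[P, r]\<close>, lowering the order; hence the nested induction.\<close>

lemma power_order_drop:
  assumes r: "r \<in> carrier R" and "P \<in> D i" and x: "x \<in> carrier R"
  shows "\<exists>y \<in> carrier R. P (r [^] (i + m) \<otimes> x) = r [^] (m::nat) \<otimes> y"
  using assms(2)
proof (induction i arbitrary: P m)
  case 0
  then obtain a where a: "a \<in> carrier R" "P = mult_op R a" by auto
  have "P (r [^] (0 + m) \<otimes> x) = r [^] m \<otimes> (a \<otimes> x)"
    using a r x by (simp add: m_lcomm)
  then show ?case using a x by blast
next
  case (Suc i)
  note outer = Suc.IH and P = \<open>P \<in> D (Suc i)\<close>
  note Pc = D_carrier[OF P]
  show ?case
  proof (induction m)
    case 0
    have "P (r [^] (Suc i + 0) \<otimes> x) = r [^] (0::nat) \<otimes> P (r [^] (Suc i + 0) \<otimes> x)"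
      using r x Pc by simp
    then show ?case by (rule bexI) (use r x Pc in simp)
  next
    case (Suc m)
    then obtain y where y: "y \<in> carrier R" "P (r [^] (Suc i + m) \<otimes> x) = r [^] m \<otimes> y"
      by blast
    obtain z where z: "z \<in> carrier R"
      "bracket P r (r [^] (i + Suc m) \<otimes> x) = r [^] Suc m \<otimes> z"
      using outer[OF D_bracket[OF P r]] by blast
    have "r [^] (Suc i + Suc m) \<otimes> x = r \<otimes> (r [^] (i + Suc m) \<otimes> x)"
      using r x by (simp add: m_ac)
    then have "P (r [^] (Suc i + Suc m) \<otimes> x) = r [^] Suc m \<otimes> z \<oplus> r \<otimes> (r [^] m \<otimes> y)"
      using bracket_expand[OF Pc r, of "r [^] (i + Suc m) \<otimes> x"] r x y z by simp
    also have "\<dots> = r [^] Suc m \<otimes> (z \<oplus> y)"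
      using r y z by (simp add: r_distr m_ac)
    finally show ?case using y z by blast
  qed
qed

text \<open>If \<open>r\<close> is regular modulo \<open>K\<close>, it is regular modulo all differential powers of \<open>K\<close>: up to the
  lower-order term \<open>[P, r](x)\<close>, the element \<open>P(rx)\<close> is \<open>r P(x)\<close>.\<close>

lemma cancel_diff_power:
  assumes K: "ideal K R" and r: "r \<in> carrier R"
    and regular: "\<And>y. y \<in> carrier R \<Longrightarrow> r \<otimes> y \<in> K \<Longrightarrow> y \<in> K"
    and x: "x \<in> carrier R"
  shows "(\<And>P. P \<in> D i \<Longrightarrow> P (r \<otimes> x) \<in> K) \<Longrightarrow> P \<in> D i \<Longrightarrow> P x \<in> K"
proof (induction i arbitrary: P)
  case 0
  then obtain a where a: "a \<in> carrier R" "P = mult_op R a" by auto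
  with 0(1)[OF 0(2)] r x have "r \<otimes> (a \<otimes> x) \<in> K" by (simp add: m_lcomm)
  then show ?case using regular a x by simp
next
  case (Suc i)
  interpret K: ideal K R by (rule K)
  note Pc = D_carrier[OF Suc.prems(2)]
  have "bracket P r x \<in> K"
    using Suc.IH[OF _ D_bracket[OF Suc.prems(2) r]] Suc.prems(1) D_Suc by blast
  then have "P (r \<otimes> x) \<ominus> bracket P r x \<in> K"
    using Suc.prems by (simp add: minus_eq K.a_closed K.a_inv_closed)
  moreover have "P (r \<otimes> x) \<ominus> bracket P r x = r \<otimes> P x"
    using bracket_closed[OF Pc r] Pc r x
    by (simp add: bracket_expand[OF Pc r x] minus_eq a_comm[of "bracket P r x"] a_assoc r_neg)
  ultimately show ?case using regular Pc x by simp
qed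

lemma cancel_power:
  assumes K: "ideal K R" and r: "r \<in> carrier R"
    and regular: "\<And>y. y \<in> carrier R \<Longrightarrow> r \<otimes> y \<in> K \<Longrightarrow> y \<in> K"
    and x: "x \<in> carrier R"
  shows "(\<And>P. P \<in> D i \<Longrightarrow> P (x \<otimes> r [^] (k::nat)) \<in> K) \<Longrightarrow> P \<in> D i \<Longrightarrow> P x \<in> K"
proof (induction k arbitrary: P)
  case 0
  then show ?case using x by simp
next
  case (Suc k)
  have eq: "x \<otimes> r [^] Suc k = r \<otimes> (x \<otimes> r [^] k)"
    using r x by (simp add: m_ac)
  show ?case
  proof (rule Suc.IH)
    fix Q assume "Q \<in> D i"
    then show "Q (x \<otimes> r [^] k) \<in> K"
      using cancel_diff_power[OF K r regular, of "x \<otimes> r [^] k" i Q] Suc.prems(1) r x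
      unfolding eq by simp
  qed (rule Suc.prems)
qed

text \<open>Composition keeps the elements that all operators send into \<open>K\<close> stable under operators:
  \<open>P(Q x)\<close> is the value at \<open>x\<close> of the operator \<open>PQ\<close>.\<close>

lemma D_core_submodule:
  assumes "ideal K R"
  shows "D_submodule A \<phi> R {x \<in> carrier R. \<forall>P \<in> diff_ops A \<phi> R. P x \<in> K}" (is "D_submodule A \<phi> R ?N")
proof -
  interpret K: ideal K R by (rule assms)
  have op: "P \<in> carrier E" if "P \<in> diff_ops A \<phi> R" for P
    using that D_carrier by (auto simp: diff_ops_def)
  have comp: "P \<otimes>\<^bsub>E\<^esub> Q \<in> diff_ops A \<phi> R" if "P \<in> diff_ops A \<phi> R" "Q \<in> diff_ops A \<phi> R" for P Q
    using that D_comp by (fastforce simp: diff_ops_def)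
  have "additive_subgroup ?N R"
  proof (rule additive_subgroupI, rule add.subgroupI)
    show "?N \<noteq> {}" using op K.zero_closed by (auto simp: End_zero intro!: exI[of _ \<zero>])
  next
    fix x assume x: "x \<in> ?N"
    have "P (\<ominus> x) \<in> K" if P: "P \<in> diff_ops A \<phi> R" for P
    proof -
      have "P (\<ominus> x) = \<ominus> P x"
        using End_minus[OF op[OF P], of \<zero> x] End_zero[OF op[OF P]] op[OF P] x
        by (simp add: minus_eq)
      then show ?thesis using P x K.a_inv_closed by simp
    qed
    then show "\<ominus> x \<in> ?N" using x by simp
  qed (use op in \<open>auto simp: End_add\<close>)
  moreover have "Q x \<in> ?N" if "Q \<in> diff_ops A \<phi> R" "x \<in> ?N" for Q x
  proof -
    have "P (Q x) \<in> K" if "P \<in> diff_ops A \<phi> R" for P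
      using comp[OF that \<open>Q \<in> _\<close>] \<open>x \<in> ?N\<close> by (metis (lifting) E_mult_apply mem_Collect_eq)
    then show ?thesis using op that by simp
  qed
  ultimately show ?thesis by (simp add: D_submodule_def)
qed

text \<open>The ideal \<open>(J : r\<^sup>\<infinity>)\<close> is the smallest one above \<open>J\<close> modulo which \<open>r\<close> is regular.\<close>

lemma saturation_ideal:
  assumes "ideal J R" and r: "r \<in> carrier R"
  shows "ideal {x \<in> carrier R. \<exists>k::nat. r [^] k \<otimes> x \<in> J} R" (is "ideal ?K R")
proof -
  interpret J: ideal J R by (rule assms(1))
  have absorb: "a \<otimes> x \<in> ?K" if a: "a \<in> carrier R" and x: "x \<in> ?K" for a x
  proof -
    from x obtain k :: nat where k: "x \<in> carrier R" "r [^] k \<otimes> x \<in> J" by blast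
    then have "a \<otimes> (r [^] k \<otimes> x) \<in> J" using a J.I_l_closed by blast
    then show ?thesis using a r k by (auto simp: m_lcomm)
  qed
  show ?thesis
  proof (rule idealI)
    show "subgroup ?K (add_monoid R)"
    proof (rule add.subgroupI)
      show "?K \<noteq> {}" using r by (auto intro!: exI[of _ \<zero>])
    next
      fix x assume "x \<in> ?K"
      then show "\<ominus> x \<in> ?K" using absorb[of "\<ominus> \<one>" x] by (auto simp: l_minus)
    next
      fix x y assume "x \<in> ?K" "y \<in> ?K"
      then obtain k l :: nat where kl: "x \<in> carrier R" "r [^] k \<otimes> x \<in> J"
        "y \<in> carrier R" "r [^] l \<otimes> y \<in> J" by blast
      have "r [^] l \<otimes> (r [^] k \<otimes> x) \<oplus> r [^] k \<otimes> (r [^] l \<otimes> y) \<in> J"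
        using kl r J.I_l_closed by (intro J.a_closed) auto
      moreover have "r [^] (k + l) \<otimes> (x \<oplus> y) =
          r [^] l \<otimes> (r [^] k \<otimes> x) \<oplus> r [^] k \<otimes> (r [^] l \<otimes> y)"
        using kl r by (simp add: nat_pow_mult[symmetric] r_distr m_ac)
      ultimately have "r [^] (k + l) \<otimes> (x \<oplus> y) \<in> J" by simp
      then show "x \<oplus> y \<in> ?K" using kl by blast
    qed auto
  next
    fix a x assume "a \<in> ?K" "x \<in> carrier R"
    then show "x \<otimes> a \<in> ?K" by (rule absorb[rotated])
  next
    fix a x assume "a \<in> ?K" "x \<in> carrier R"
    then show "a \<otimes> x \<in> ?K" using absorb[of x a] by (simp add: m_comm)
  qed (rule ring_axioms)
qed

end

section \<open>Differential closures in a domain\<close>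

locale domain_algebra = comm_algebra R A \<phi> + domain R
  for R :: "('r, 'm) ring_scheme" (structure) and A :: "('a, 'k) ring_scheme" and \<phi> :: "'a \<Rightarrow> 'r"
begin

lemma diff_closure_D_submodule:
  assumes I: "D_submodule A \<phi> R I" and "I \<noteq> {\<zero>}"
  shows "diff_closure A \<phi> R I = carrier R"
proof -
  interpret I: ideal I R by (rule D_submodule_ideal[OF I])
  obtain c where c: "c \<in> I" "c \<noteq> \<zero>" using assms(2) I.zero_closed by blast
  then have "c \<in> carrier R" using I.a_subset by blast
  have "c \<otimes> r [^] n \<in> diff_power A \<phi> R I n" if "r \<in> carrier R" for r and n :: nat
  proof -
    have "c \<otimes> r [^] n \<in> I" using c(1) that by (simp add: I.I_r_closed)
    moreover have "P x \<in> I" if "P \<in> D i" "x \<in> I" for P i x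
      using I that unfolding D_submodule_def diff_ops_def by blast
    ultimately show ?thesis using \<open>c \<in> carrier R\<close> that by (simp add: diff_power_def)
  qed
  then have "r \<in> diff_closure A \<phi> R I" if "r \<in> carrier R" for r
    using that c(2) \<open>c \<in> carrier R\<close> unfolding diff_closure_def
    by (intro CollectI conjI bexI[of _ c]) simp_all
  then show ?thesis by (auto simp: diff_closure_def)
qed

text \<open>The zero element has to be treated apart, as its powers cannot serve as multipliers.\<close>

lemma radical_subset_diff_closure:
  assumes "ideal J R" shows "radical R J \<subseteq> diff_closure A \<phi> R J"
proof
  interpret J: ideal J R by (rule assms)
  fix r assume "r \<in> radical R J"
  then obtain m :: nat where r: "r \<in> carrier R" and m: "r [^] m \<in> J" "m \<ge> 1"
    by (auto simp: radical_def)
  show "r \<in> diff_closure A \<phi> R J"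
  proof (cases "r = \<zero>")
    case True
    have "\<one> \<otimes> r [^] n \<in> diff_power A \<phi> R J n" if "n \<ge> 1" for n :: nat
      using True that by (auto simp: diff_power_def nat_pow_zero End_zero[OF D_carrier])
    then show ?thesis using r one_not_zero unfolding diff_closure_def
      by (auto simp: eventually_sequentially intro!: bexI[of _ \<one>] exI[of _ "1::nat"])
  next
    case False
    have "r [^] m \<otimes> r [^] n \<in> diff_power A \<phi> R J n" if "n \<ge> 1" for n :: nat
    proof -
      have "P (r [^] m \<otimes> r [^] n) \<in> J" if P: "P \<in> D (n - 1)" for P
      proof -
        have eq: "r [^] m \<otimes> r [^] n = r [^] (n - 1 + m) \<otimes> r"
          using r \<open>n \<ge> 1\<close> by (simp add: nat_pow_mult nat_pow_Suc[symmetric] add.commute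
              del: nat_pow_Suc)
        obtain y where "y \<in> carrier R" "P (r [^] m \<otimes> r [^] n) = r [^] m \<otimes> y"
          using power_order_drop[OF r P r, of m] unfolding eq by blast
        then show ?thesis using m(1) J.I_r_closed by simp
      qed
      then show ?thesis using r by (simp add: diff_power_def)
    qed
    moreover have "r [^] m \<noteq> \<zero>" using r False by (induction m) (simp_all add: integral_iff)
    ultimately show ?thesis using r unfolding diff_closure_def
      by (auto simp: eventually_sequentially intro!: bexI[of _ "r [^] m"] exI[of _ "1::nat"])
  qed
qed

text \<open>A multiplier \<open>c\<close> for an \<open>r\<close> outside the radical would lie in a \<open>D\<close>-submodule avoiding \<open>1\<close>:
  modulo the saturation \<open>K\<close>, the powers of \<open>r\<close> cancel from \<open>c r\<^sup>n\<close>.\<close>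

lemma diff_closure_subset_radical:
  assumes simple: "D_simple A \<phi> R" and J: "ideal J R"
  shows "diff_closure A \<phi> R J \<subseteq> radical R J"
proof (rule subsetI, rule ccontr)
  interpret J: ideal J R by (rule J)
  fix r assume "r \<in> diff_closure A \<phi> R J" and nrad: "r \<notin> radical R J"
  then obtain c n0 where r: "r \<in> carrier R" and c: "c \<in> carrier R" "c \<noteq> \<zero>"
    and mem: "\<And>n. n \<ge> n0 \<Longrightarrow> c \<otimes> r [^] n \<in> diff_power A \<phi> R J n"
    by (auto simp: diff_closure_def eventually_sequentially)
  define K where "K = {x \<in> carrier R. \<exists>k::nat. r [^] k \<otimes> x \<in> J}"
  have K: "ideal K R" unfolding K_def by (rule saturation_ideal[OF J r])
  have "J \<subseteq> K"
    using J.a_subset by (auto simp: K_def intro!: exI[of _ "0::nat"])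
  have regular: "y \<in> K" if y: "y \<in> carrier R" "r \<otimes> y \<in> K" for y
  proof -
    obtain k :: nat where "r [^] k \<otimes> (r \<otimes> y) \<in> J" using y(2) by (auto simp: K_def)
    then have "r [^] Suc k \<otimes> y \<in> J" using r y(1) by (simp add: m_assoc)
    then show ?thesis using y(1) unfolding K_def by blast
  qed
  have "\<one> \<notin> K"
  proof
    assume "\<one> \<in> K"
    then obtain k :: nat where "r [^] k \<in> J" using r by (auto simp: K_def)
    \<comment> \<open>The radical asks for a positive exponent, and \<open>k\<close> may be \<open>0\<close>.\<close>
    then have "r [^] Suc k \<in> J" using r J.I_r_closed by simp
    then show False using nrad r unfolding radical_def by fastforce
  qed
  have "P c \<in> K" if "P \<in> D i" for P i
  proof -
    define n where "n = max n0 (Suc i)"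
    have "i \<le> n - 1" unfolding n_def by linarith
    then have P: "P \<in> D (n - 1)" using that D_mono by blast
    have "Q (c \<otimes> r [^] n) \<in> K" if "Q \<in> D (n - 1)" for Q
      using mem[of n] that \<open>J \<subseteq> K\<close> by (auto simp: n_def diff_power_def)
    then show ?thesis using cancel_power[OF K r regular c(1) _ P] by blast
  qed
  then have "c \<in> {x \<in> carrier R. \<forall>P \<in> diff_ops A \<phi> R. P x \<in> K}"
    using c(1) by (auto simp: diff_ops_def)
  then have "{x \<in> carrier R. \<forall>P \<in> diff_ops A \<phi> R. P x \<in> K} = carrier R"
    using simple D_core_submodule[OF K] c(2) unfolding D_simple_def by blast
  then have "mult_op R \<one> \<one> \<in> K" using mult_op_diff_op[of \<one>] by blast
  then show False using \<open>\<one> \<notin> K\<close> by simp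
qed

lemma D_simple_if_radical_eq:
  assumes "\<And>J. ideal J R \<Longrightarrow> radical R J = diff_closure A \<phi> R J"
  shows "D_simple A \<phi> R"
  unfolding D_simple_def
proof (intro allI impI)
  fix N assume N: "D_submodule A \<phi> R N"
  interpret N: ideal N R by (rule D_submodule_ideal[OF N])
  have "N = carrier R" if "N \<noteq> {\<zero>}"
  proof -
    have "\<one> \<in> radical R N"
      using assms[OF N.ideal_axioms] diff_closure_D_submodule[OF N that] by simp
    then show ?thesis using N.one_imp_carrier by (auto simp: radical_def)
  qed
  then show "N = {\<zero>} \<or> N = carrier R" by blast
qed

end

theorem theorem6p10p1:
  fixes A :: "('a, 'k) ring_scheme" and B :: "('b, 'l) ring_scheme" and R :: "('r, 'm) ring_scheme"
    and \<eta> :: "'a \<Rightarrow> 'b" and \<psi> :: "'b \<Rightarrow> 'r" and \<phi> :: "'a \<Rightarrow> 'r" and W :: "'b set"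
  assumes "cring A" and "noetherian_ring A"
    and "domain R" and "\<phi> \<in> ring_hom A R"
    \<comment> \<open>\<open>R\<close> is essentially of finite type over \<open>A\<close>: a localization, as an \<open>A\<close>-algebra, of some finite
      type \<open>A\<close>-algebra \<open>B\<close>; the choice of \<open>B\<close> is arbitrary and does not occur in the conclusion\<close>
    and "cring B" and "finite_type_algebra A \<eta> B"
    and "is_localization B W \<psi> R" and "\<forall>a \<in> carrier A. \<phi> a = \<psi> (\<eta> a)"
  shows "(\<forall>I. D_submodule A \<phi> R I \<and> I \<noteq> {\<zero>\<^bsub>R\<^esub>} \<longrightarrow> diff_closure A \<phi> R I = carrier R) \<and>
    ((\<forall>J. ideal J R \<longrightarrow> radical R J = diff_closure A \<phi> R J) \<longleftrightarrow> D_simple A \<phi> R)"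
proof -
  interpret domain R by (rule assms(3))
  interpret domain_algebra R A \<phi> by unfold_locales (rule assms(4))
  show ?thesis
  proof (intro conjI allI impI iffI)
    fix J assume "D_simple A \<phi> R" "ideal J R"
    then show "radical R J = diff_closure A \<phi> R J"
      using radical_subset_diff_closure diff_closure_subset_radical by blast
  qed (simp_all add: diff_closure_D_submodule D_simple_if_radical_eq)
qed

end
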